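(* Let $r\geq1$, $\mathbf{s}=(s_1,\dots,s_r)\in\mathbb{Z}^r$ and $\boldsymbol{\epsilon}=(\epsilon_1,\dots,\epsilon_r)\in\{\pm1\}^r$. (1) For every odd prime $l$, \[\zeta_{\mathcal{A}}(\mathbf{s};\boldsymbol{\epsilon})_l\equiv -C_{l-2}^{(s_1-1,s_2,\dots,s_r);\,\boldsymbol{\epsilon}} \pmod l.\] (2) Let $r'\in\mathbb{N}$, $\bar{\mathbf{s}}=(1,\dots,1,s_1,\dots,s_r)\in\mathbb{Z}^{r+r'}$ and $\bar{\boldsymbol{\epsilon}}=(1,\dots,1,\epsilon_1,\dots,\epsilon_r)\in\{\pm1\}^{r+r'}$ (with $r'$ leading entries equal to $1$ in each). Then for every odd prime $l$ with $l\geq r'+2$, \[\zeta_{\mathcal{A}}(\bar{\mathbf{s}};\bar{\boldsymbol{\epsilon}})_l\equiv -C_{l-r'-2}^{(s_1-1,s_2,\dots,s_r);\,\boldsymbol{\epsilon}} \pmod l.\]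
   Context: For $\mathbf{s}\in\mathbb{Z}^r$ and $\boldsymbol{\epsilon}\in\{\pm1\}^r$ and a prime $l$, $\zeta_{\mathcal{A}}(\mathbf{s};\boldsymbol{\epsilon})_l:=\sum_{l>n_1>\cdots>n_r>0}\frac{\epsilon_1^{n_1}\cdots\epsilon_r^{n_r}}{n_1^{s_1}\cdots n_r^{s_r}}\in\mathbb{Z}/l\mathbb{Z}$. With $\mathrm{Li}_{\mathbf{s}}(z_1,\dots,z_r)=\sum_{n_1>\cdots>n_r\geq1}\frac{z_1^{n_1}\cdots z_r^{n_r}}{n_1^{s_1}\cdots n_r^{s_r}}$, the rationals $C_n^{\mathbf{s};\boldsymbol{\epsilon}}$ are defined by $\sum_{n\geq0}C_n^{\mathbf{s};\boldsymbol{\epsilon}}\frac{x^n}{n!}=e^{-x}\frac{\mathrm{Li}_{\mathbf{s}}((1-e^{-x})\epsilon_1,\epsilon_2,\dots,\epsilon_r)}{1-e^{-x}}$; the congruences are between $l$-integral rationals reduced mod $l$. *)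

theory Defs
  imports
    "HOL-Computational_Algebra.Formal_Power_Series"
    "HOL-Computational_Algebra.Primes"
begin

(* Tuples (n_1, ..., n_r) with N > n_1 > ... > n_r > 0, as lists of length r. *)
definition dec_tuples :: "nat \<Rightarrow> nat \<Rightarrow> nat list set" where
  "dec_tuples r N = {ns. length ns = r \<and> sorted_wrt (>) ns \<and> set ns \<subseteq> {0<..<N}}"

lemma finite_dec_tuples: "finite (dec_tuples r N)"
  by (rule finite_subset[OF _ finite_lists_length_eq[of "{0<..<N}" r]])
     (auto simp: dec_tuples_def)

(* z_1^{n_1} ... z_r^{n_r} / (n_1^{s_1} ... n_r^{s_r}), where r is the length of s. *)
definition multi_term :: "int list \<Rightarrow> rat list \<Rightarrow> nat list \<Rightarrow> rat" where
  "multi_term s z ns =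
     (\<Prod>i<length s. (z ! i) ^ (ns ! i) / (of_nat (ns ! i) powi (s ! i)))"

(* The l-component of the finite multiple zeta value, kept as a rational number: its
   denominators are products of n_i < l, so for l prime it is l-integral, and its class
   modulo l (see rat_cong below) is the element of Z/lZ in question. *)
definition zeta_A :: "int list \<Rightarrow> rat list \<Rightarrow> nat \<Rightarrow> rat" where
  "zeta_A s eps l = (\<Sum>ns\<in>dec_tuples (length s) l. multi_term s eps ns)"

(* Li_s(t z_1, z_2, ..., z_r) as a formal power series in t (r >= 1): the coefficient of t^n
   collects the finitely many tuples with n_1 = n. *)
definition Li_fps :: "int list \<Rightarrow> rat list \<Rightarrow> rat fps" where
  "Li_fps s z =
     Abs_fps (\<lambda>n. \<Sum>ns\<in>{ns \<in> dec_tuples (length s) (Suc n). hd ns = n}. multi_term s z ns)"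

definition C_gf :: "int list \<Rightarrow> rat list \<Rightarrow> rat fps" where
  "C_gf s eps =
     fps_exp (-1) * (fps_compose (Li_fps s eps) (1 - fps_exp (-1)) / (1 - fps_exp (-1)))"

(* C_gf is the exponential generating function of the C_coeff. *)
definition C_coeff :: "int list \<Rightarrow> rat list \<Rightarrow> nat \<Rightarrow> rat" where
  "C_coeff s eps n = fact n * fps_nth (C_gf s eps) n"

(* For l prime: membership in the localization of Z at (l). *)
definition l_integral :: "nat \<Rightarrow> rat \<Rightarrow> bool" where
  "l_integral l q \<longleftrightarrow> \<not> int l dvd snd (quotient_of q)"

(* Both sides are l-integral and they have the same image in Z/lZ, i.e. they differ by l times
   an l-integral rational. *)
definition rat_cong :: "nat \<Rightarrow> rat \<Rightarrow> rat \<Rightarrow> bool" where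
  "rat_cong l a b \<longleftrightarrow> l_integral l a \<and> l_integral l b \<and> (\<exists>c. l_integral l c \<and> a - b = of_nat l * c)"

end

(* Put u = 1 - exp (-x), so that u' = exp (-x) = 1 - u. The operator t d/dt lowers the first
   exponent of Li_s by one, so the generating function of the C_n of (s_1 - 1, s_2, ...) is the
   derivative of Li_s(u): C_(l-2) is (l-1)! times the coefficient of x^(l-1) in the sum of
   c_n u^n, where c_n is the n-th coefficient of Li_s. Expanding u^n by the binomial theorem and
   using Fermat's little theorem, (l-1)! [x^(l-1)] u^n is congruent to -1 for 0 < n < l, which
   gives (1). Part (2) is (1) for the extended tuple: Li_(0,s)(u) = u Li_s(u) / (1 - u), so
   removing a leading 0 from the upper index and differentiating once leaves the generating
   function of the C_n of (s_1 - 1, s_2, ...); each leading 1 thus shifts n by one. *)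
theory Submission
  imports Defs "HOL-Number_Theory.Residues"
begin

unbundle fps_syntax

section \<open>Localization at a prime\<close>

text \<open>The definition inspects the reduced fraction; this form admits any fraction, so closure
  under sums and products is immediate. Were \<open>l\<close> a divisor of the reduced denominator,
  \<open>p * b = a * d\<close> would force it to divide \<open>p\<close> too, against
  coprimality.\<close>

lemma l_integral_iff:
  assumes "prime l"
  shows "l_integral l q \<longleftrightarrow> (\<exists>a b. \<not> int l dvd b \<and> q = of_int a / of_int b)"
proof
  assume "l_integral l q"
  then show "\<exists>a b. \<not> int l dvd b \<and> q = of_int a / of_int b"
    unfolding l_integral_def by (metis prod.collapse quotient_of_div)
next
  assume "\<exists>a b. \<not> int l dvd b \<and> q = of_int a / of_int b"
  then obtain a b where ab: "\<not> int l dvd b" "q = of_int a / of_int b" by blast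
  obtain p d where pd: "quotient_of q = (p, d)" by force
  have d: "d > 0" "coprime p d" "q = of_int p / of_int d"
    using pd quotient_of_denom_pos quotient_of_coprime quotient_of_div by auto
  have "b \<noteq> 0" using ab by auto
  then have "(of_int (p * b) :: rat) = of_int (a * d)"
    using ab d by (simp add: field_simps)
  then have eq: "p * b = a * d" by (simp only: of_int_eq_iff)
  have "\<not> int l dvd d"
  proof
    assume l: "int l dvd d"
    then have "int l dvd p * b" using eq by simp
    then have "int l dvd p" using ab assms by (simp add: prime_dvd_mult_iff)
    then have "int l dvd 1" using l d(2) by (meson coprime_common_divisor)
    then show False using assms by (simp add: prime_nat_iff)
  qed
  then show "l_integral l q" by (simp add: l_integral_def pd)
qed

lemma l_integral_of_int: "prime l \<Longrightarrow> l_integral l (of_int a)"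
  by (auto simp: l_integral_def prime_nat_iff)

lemma l_integral_add:
  assumes "prime l" "l_integral l x" "l_integral l y"
  shows "l_integral l (x + y)"
proof -
  obtain a b c d where *: "\<not> int l dvd b" "x = of_int a / of_int b"
      "\<not> int l dvd d" "y = of_int c / of_int d"
    using assms by (auto simp: l_integral_iff)
  then have "b \<noteq> 0" "d \<noteq> 0" by auto
  then have "x + y = of_int (a * d + c * b) / of_int (b * d)"
    using * by (simp add: field_simps)
  moreover have "\<not> int l dvd b * d" using * assms(1) by (simp add: prime_dvd_mult_iff)
  ultimately show ?thesis using assms(1) l_integral_iff by blast
qed

lemma l_integral_mult:
  assumes "prime l" "l_integral l x" "l_integral l y"
  shows "l_integral l (x * y)"
proof -
  obtain a b c d where *: "\<not> int l dvd b" "x = of_int a / of_int b"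
      "\<not> int l dvd d" "y = of_int c / of_int d"
    using assms by (auto simp: l_integral_iff)
  then have "x * y = of_int (a * c) / of_int (b * d)" by simp
  moreover have "\<not> int l dvd b * d" using * assms(1) by (simp add: prime_dvd_mult_iff)
  ultimately show ?thesis using assms(1) l_integral_iff by blast
qed

lemma l_integral_minus: "prime l \<Longrightarrow> l_integral l x \<Longrightarrow> l_integral l (- x)"
  using l_integral_mult[of l "of_int (- 1)" x] l_integral_of_int[of l "- 1"] by simp

lemma l_integral_sum:
  assumes "prime l" "\<And>i. i \<in> A \<Longrightarrow> l_integral l (f i)"
  shows "l_integral l (\<Sum>i\<in>A. f i)"
  using assms(2) l_integral_of_int[OF assms(1), of 0]
  by (induction A rule: infinite_finite_induct) (auto intro: l_integral_add assms(1))

lemma l_integral_prod: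
  assumes "prime l" "\<And>i. i \<in> A \<Longrightarrow> l_integral l (f i)"
  shows "l_integral l (\<Prod>i\<in>A. f i)"
  using assms(2) l_integral_of_int[OF assms(1), of 1]
  by (induction A rule: infinite_finite_induct) (auto intro: l_integral_mult assms(1))

lemma l_integral_power: "prime l \<Longrightarrow> l_integral l x \<Longrightarrow> l_integral l (x ^ k)"
  using l_integral_prod[of l "{..<k}" "\<lambda>_. x"] by simp

lemma l_integral_powi:
  assumes "prime l" "l_integral l x" "l_integral l (inverse x)"
  shows "l_integral l (x powi k)"
  using assms by (simp add: power_int_def l_integral_power)

lemma l_integral_inverse_of_nat:
  assumes "prime l" "0 < n" "n < l"
  shows "l_integral l (inverse (of_nat n))"
proof -
  have "\<not> int l dvd int n" using assms by (simp add: nat_dvd_not_less)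
  moreover have "inverse (of_nat n :: rat) = of_int 1 / of_int (int n)"
    by (simp add: divide_inverse)
  ultimately show ?thesis using assms(1) l_integral_iff by blast
qed

section \<open>Coefficients of polylogarithms\<close>

lemma dec_tuples_length: "ns \<in> dec_tuples r N \<Longrightarrow> length ns = r"
  by (simp add: dec_tuples_def)

lemma Cons_mem_dec_tuples_iff:
  "n # ms \<in> dec_tuples (Suc r) N \<longleftrightarrow> n \<in> {0<..<N} \<and> ms \<in> dec_tuples r n"
  by (fastforce simp: dec_tuples_def)

text \<open>Splits off the largest entry \<open>n\<close>; the others form a decreasing tuple below
  \<open>n\<close>.\<close>

lemma sum_dec_tuples_Suc:
  fixes f :: "nat list \<Rightarrow> 'a::comm_monoid_add"
  shows "(\<Sum>ns\<in>dec_tuples (Suc r) N. f ns) = (\<Sum>n\<in>{0<..<N}. \<Sum>ms\<in>dec_tuples r n. f (n # ms))"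
proof -
  have "dec_tuples (Suc r) N = (\<lambda>(n, ms). n # ms) ` (SIGMA n:{0<..<N}. dec_tuples r n)"
  proof (intro Set.set_eqI iffI)
    fix ns assume ns: "ns \<in> dec_tuples (Suc r) N"
    then obtain n ms where "ns = n # ms"
      using dec_tuples_length by (metis length_Suc_conv)
    then show "ns \<in> (\<lambda>(n, ms). n # ms) ` (SIGMA n:{0<..<N}. dec_tuples r n)"
      using ns by (auto simp: Cons_mem_dec_tuples_iff image_iff)
  qed (auto simp: Cons_mem_dec_tuples_iff)
  moreover have "inj_on (\<lambda>(n, ms). n # ms) (SIGMA n:{0<..<N}. dec_tuples r n)"
    by (auto simp: inj_on_def)
  ultimately show ?thesis
    by (simp add: sum.reindex sum.Sigma finite_dec_tuples case_prod_unfold)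
qed

lemma multi_term_Cons:
  "multi_term (a # s) (e # z) (n # ms) = e ^ n / of_nat n powi a * multi_term s z ms"
  by (simp add: multi_term_def prod.lessThan_Suc_shift del: prod.lessThan_Suc)

lemma l_integral_multi_term:
  assumes "prime l" "length s = length z" "set z \<subseteq> {1, - 1}" "ns \<in> dec_tuples (length s) l"
  shows "l_integral l (multi_term s z ns)"
  unfolding multi_term_def
proof (rule l_integral_prod[OF assms(1)])
  fix i assume "i \<in> {..<length s}"
  then have "z ! i \<in> set z" "ns ! i \<in> set ns"
    using assms(2,4) by (auto simp: dec_tuples_def)
  then have "z ! i \<in> {1, - 1}" "ns ! i \<in> {0<..<l}"
    using assms(3,4) by (auto simp: dec_tuples_def)
  then have z: "l_integral l (z ! i)" and n: "0 < ns ! i" "ns ! i < l"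
    using l_integral_of_int[OF assms(1), of 1] l_integral_of_int[OF assms(1), of "- 1"] by auto
  have "l_integral l (of_nat (ns ! i))"
    using l_integral_of_int[OF assms(1), of "int (ns ! i)"] by simp
  then have "l_integral l (of_nat (ns ! i) powi (- (s ! i)))"
    using l_integral_powi[OF assms(1)] l_integral_inverse_of_nat[OF assms(1) n] by blast
  then show "l_integral l (z ! i ^ ns ! i / of_nat (ns ! i) powi (s ! i))"
    using l_integral_mult[OF assms(1) l_integral_power[OF assms(1) z]]
    by (simp add: power_int_minus divide_inverse)
qed

lemma Li_fps_nth:
  "Li_fps (a # s) z $ n =
     (if n = 0 then 0 else \<Sum>ms\<in>dec_tuples (length s) n. multi_term (a # s) z (n # ms))"
proof -
  have "Li_fps (a # s) z $ n =
      (\<Sum>ns\<in>dec_tuples (Suc (length s)) (Suc n). if hd ns = n then multi_term (a # s) z ns else 0)"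
    by (simp add: Li_fps_def sum.inter_filter finite_dec_tuples)
  also have "\<dots> = (\<Sum>m\<in>{0<..<Suc n}. if m = n then
      \<Sum>ms\<in>dec_tuples (length s) n. multi_term (a # s) z (n # ms) else 0)"
    unfolding sum_dec_tuples_Suc by (intro sum.cong) auto
  also have "\<dots> = (if n = 0 then 0 else \<Sum>ms\<in>dec_tuples (length s) n. multi_term (a # s) z (n # ms))"
    by (simp add: sum.delta)
  finally show ?thesis .
qed

lemma sum_Li_fps_nth: "(\<Sum>n\<in>{0<..<N}. Li_fps (a # s) z $ n) = zeta_A (a # s) z N"
  by (simp add: zeta_A_def sum_dec_tuples_Suc Li_fps_nth)

text \<open>The denominators are built from integers between 1 and \<open>n\<close>, all prime to
  \<open>l\<close>.\<close>

lemma l_integral_Li_fps_nth: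
  assumes "prime l" "length z = Suc (length s)" "set z \<subseteq> {1, - 1}" "n < l"
  shows "l_integral l (Li_fps (a # s) z $ n)"
proof (cases "n = 0")
  case True
  then show ?thesis using l_integral_of_int[OF assms(1), of 0] by (simp add: Li_fps_nth)
next
  case False
  then show ?thesis
    using assms
    by (auto simp: Li_fps_nth Cons_mem_dec_tuples_iff
        intro!: l_integral_sum l_integral_multi_term)
qed

lemma fps_X_mult_deriv_Li_fps:
  "fps_X * fps_deriv (Li_fps (a # s) (e # z)) = Li_fps ((a - 1) # s) (e # z)"
proof (rule fps_ext)
  fix n
  show "(fps_X * fps_deriv (Li_fps (a # s) (e # z))) $ n = Li_fps ((a - 1) # s) (e # z) $ n"
  proof (cases n)
    case (Suc m)
    have "of_nat n * multi_term (a # s) (e # z) (n # ms) =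
        multi_term ((a - 1) # s) (e # z) (n # ms)" for ms
      using Suc by (simp add: multi_term_Cons power_int_diff del: of_nat_Suc)
    then show ?thesis
      using Suc by (simp add: Li_fps_nth sum_distrib_left del: of_nat_Suc)
  qed (simp add: Li_fps_nth)
qed

text \<open>With leading exponent 0 and sign 1, the coefficient at \<open>n\<close> is the sum of
  the coefficients of the shorter series below \<open>n\<close>. Multiplication by
  \<open>1 - fps_X\<close> telescopes these sums; the strict bound accounts for the factor
  \<open>fps_X\<close>.\<close>

lemma Li_fps_zero_Cons:
  "(1 - fps_X) * Li_fps (0 # a # s) (1 # z) = fps_X * Li_fps (a # s) z"
proof (rule fps_ext)
  have nth: "Li_fps (0 # a # s) (1 # z) $ n = (\<Sum>m\<in>{0<..<n}. Li_fps (a # s) z $ m)" for n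
    unfolding sum_Li_fps_nth zeta_A_def by (auto simp: Li_fps_nth multi_term_Cons sum_dec_tuples_Suc)
  fix n
  show "((1 - fps_X) * Li_fps (0 # a # s) (1 # z)) $ n = (fps_X * Li_fps (a # s) z) $ n"
  proof (cases n)
    case (Suc m)
    then show ?thesis
    proof (cases "m = 0")
      case False
      then have "{0<..<Suc m} = insert m {0<..<m}" by auto
      then show ?thesis using Suc by (simp add: left_diff_distrib nth)
    qed (simp add: left_diff_distrib nth Li_fps_nth[of a s z 0])
  qed (simp add: left_diff_distrib nth)
qed

section \<open>The generating function\<close>

abbreviation fps_u :: "rat fps" where
  "fps_u \<equiv> 1 - fps_exp (- 1)"

lemma fps_const_minus_1: "fps_const (- 1 :: 'a::ring_1) = - 1"
  by (simp flip: fps_const_neg)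

lemma fps_u_nonzero: "fps_u \<noteq> 0"
proof
  assume "fps_u = 0"
  then have "fps_u $ 1 = 0 $ 1" by simp
  then show False by simp
qed

text \<open>Chain rule: lowering the exponent produces a factor \<open>fps_u\<close>, which cancels
  the denominator of \<open>C_gf\<close>, and the remaining \<open>fps_exp (- 1)\<close> is the
  derivative of \<open>fps_u\<close>.\<close>

lemma C_gf_pred:
  "C_gf ((a - 1) # s) (e # z) = fps_deriv (fps_compose (Li_fps (a # s) (e # z)) fps_u)"
proof -
  let ?L = "Li_fps (a # s) (e # z)"
  have "fps_compose (Li_fps ((a - 1) # s) (e # z)) fps_u = fps_u * fps_compose (fps_deriv ?L) fps_u"
    by (simp flip: fps_X_mult_deriv_Li_fps add: fps_compose_mult_distrib)
  then have "C_gf ((a - 1) # s) (e # z) = fps_exp (- 1) * fps_compose (fps_deriv ?L) fps_u"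
    using fps_u_nonzero by (simp add: C_gf_def)
  moreover have "fps_deriv fps_u = fps_exp (- 1)"
    by (simp add: fps_const_minus_1)
  ultimately show ?thesis
    by (simp add: fps_compose_deriv mult.commute del: fps_deriv_sub)
qed

lemma C_gf_zero_Cons: "C_gf (0 # a # s) (1 # z) = fps_compose (Li_fps (a # s) z) fps_u"
proof -
  let ?M = "fps_compose (Li_fps (0 # a # s) (1 # z)) fps_u"
  have "fps_compose ((1 - fps_X) * Li_fps (0 # a # s) (1 # z)) fps_u = fps_exp (- 1) * ?M"
    by (simp add: fps_compose_mult_distrib fps_compose_sub_distrib)
  then have eq: "fps_exp (- 1) * ?M = fps_u * fps_compose (Li_fps (a # s) z) fps_u"
    by (simp add: Li_fps_zero_Cons fps_compose_mult_distrib)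
  \<comment> \<open>Raising the leading exponent from 0 to 1 exhibits the factor
    \<open>fps_u\<close> of \<open>?M\<close>; this makes the division in \<open>C_gf\<close> exact,
    so that it commutes with multiplication by \<open>fps_exp (- 1)\<close>.\<close>
  have "?M = fps_u * fps_compose (fps_deriv (Li_fps (1 # a # s) (1 # z))) fps_u"
    using fps_X_mult_deriv_Li_fps[of 1 "a # s" 1 z, symmetric]
    by (simp add: fps_compose_mult_distrib)
  then have "fps_u dvd ?M" by simp
  then have "C_gf (0 # a # s) (1 # z) = fps_exp (- 1) * ?M / fps_u"
    by (simp add: C_gf_def div_mult_swap)
  then show ?thesis
    using fps_u_nonzero by (simp add: eq)
qed

text \<open>The generating function on the right is the derivative of the one on the left, and
  differentiation shifts exponential coefficients by one.\<close>

lemma C_coeff_zero_Cons: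
  "C_coeff (0 # a # s) (1 # e # z) (Suc m) = C_coeff ((a - 1) # s) (e # z) m"
  by (simp add: C_coeff_def C_gf_zero_Cons C_gf_pred algebra_simps)

lemma C_coeff_replicate:
  "C_coeff ((hd (replicate k 1 @ a # s) - 1) # tl (replicate k 1 @ a # s))
       (replicate k 1 @ e # z) (m + k) = C_coeff ((a - 1) # s) (e # z) m"
proof (induction k)
  case (Suc k)
  then show ?case
    \<comment> \<open>The case split exposes the entry after the removed leading 1: \<open>a\<close>
      for \<open>k = 0\<close>, another 1 otherwise.\<close>
    by (cases k) (simp_all add: C_coeff_zero_Cons)
qed simp

section \<open>The prime case\<close>

text \<open>Equals \<open>(- 1) ^ (n + k) * fact n\<close> times the Stirling number of the second
  kind of \<open>k\<close> and \<open>n\<close>; integer-valued so that divisibility by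
  \<open>l\<close> can be discussed directly.\<close>

definition pow_coeff :: "nat \<Rightarrow> nat \<Rightarrow> int" where
  "pow_coeff n k = (\<Sum>i\<le>n. int (n choose i) * (- 1) ^ i * (- int i) ^ k)"

lemma fps_u_power_nth: "fact k * (fps_u ^ n $ k) = of_int (pow_coeff n k)"
proof -
  have pow: "(- fps_exp (- 1)) ^ i = fps_const ((- 1) ^ i) * fps_exp (- of_nat i :: rat)" for i
  proof -
    have "- fps_exp (- 1) = fps_const (- 1) * fps_exp (- 1 :: rat)"
      by (simp add: fps_const_minus_1)
    then show ?thesis
      by (simp only: power_mult_distrib fps_const_power fps_exp_power_mult) simp
  qed
  have "fps_u ^ n = (- fps_exp (- 1) + 1) ^ n" by simp
  also have "\<dots> = (\<Sum>i\<le>n. of_nat (n choose i) * (- fps_exp (- 1)) ^ i * 1 ^ (n - i))"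
    by (rule binomial_ring)
  also have "\<dots> = (\<Sum>i\<le>n. fps_const (of_nat (n choose i) * (- 1) ^ i) * fps_exp (- of_nat i))"
    by (simp add: pow flip: fps_const_mult fps_of_nat add: mult.assoc)
  finally show ?thesis
    by (simp add: pow_coeff_def fps_sum_nth sum_distrib_left field_simps)
qed

text \<open>By Fermat, modulo \<open>l\<close> the sum becomes the alternating sum of binomial
  coefficients, which is 0, without its term 1 at \<open>i = 0\<close>.\<close>

lemma dvd_Suc_pow_coeff:
  assumes "prime l" "odd l" "0 < n" "n < l"
  shows "int l dvd 1 + pow_coeff n (l - 1)"
proof -
  \<comment> \<open>Evenness removes the sign of \<open>- int i\<close>; positivity makes the power
    vanish at \<open>i = 0\<close>.\<close>
  have l: "l - 1 > 0" "even (l - 1)" using assms prime_gt_1_nat[of l] by auto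
  \<comment> \<open>The last summand corrects \<open>i = 0\<close>, where Fermat fails: it makes
    \<open>?g 0\<close> zero and adds exactly 1 to the total.\<close>
  let ?g = "\<lambda>i. (- int i) ^ (l - 1) - 1 + (if i = 0 then 1 else 0)"
  have "(\<Sum>i\<le>n. int (n choose i) * (- 1) ^ i * ?g i) =
      pow_coeff n (l - 1) - (\<Sum>i\<le>n. (- 1) ^ i * int (n choose i))
        + (\<Sum>i\<le>n. if i = 0 then 1 else 0)"
    unfolding pow_coeff_def
    by (simp only: sum.distrib[symmetric] sum_subtractf[symmetric])
      (intro sum.cong, auto simp: algebra_simps)
  then have "1 + pow_coeff n (l - 1) = (\<Sum>i\<le>n. int (n choose i) * (- 1) ^ i * ?g i)"
    using choose_alternating_sum[OF assms(3), where 'a = int] by (simp add: sum.delta)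
  moreover have "int l dvd ?g i" if "i \<le> n" for i
  proof (cases "i = 0")
    case False
    then have "\<not> l dvd i" using that assms by (simp add: nat_dvd_not_less)
    then have "[i ^ (l - 1) = 1] (mod l)" using fermat_theorem assms(1) by blast
    then have "[int i ^ (l - 1) = 1] (mod int l)"
      using cong_int_iff[of "i ^ (l - 1)" 1 l] by simp
    then show ?thesis using False l by (simp add: cong_iff_dvd_diff)
  qed (use l in \<open>simp add: zero_power\<close>)
  ultimately show ?thesis by (auto intro!: dvd_sum)
qed

lemma C_coeff_pred:
  "C_coeff ((a - 1) # s) (e # z) m =
     (\<Sum>n\<in>{0<..<m + 2}. Li_fps (a # s) (e # z) $ n * of_int (pow_coeff n (m + 1)))"
proof -
  have "C_coeff ((a - 1) # s) (e # z) m =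
      fact (m + 1) * (fps_compose (Li_fps (a # s) (e # z)) fps_u $ (m + 1))"
    by (simp add: C_coeff_def C_gf_pred algebra_simps)
  also have "\<dots> = (\<Sum>n=0..m + 1. Li_fps (a # s) (e # z) $ n * of_int (pow_coeff n (m + 1)))"
    unfolding fps_compose_nth sum_distrib_left
    by (intro sum.cong refl) (simp flip: fps_u_power_nth add: mult_ac)
  also have "\<dots> = (\<Sum>n\<in>{0<..<m + 2}. Li_fps (a # s) (e # z) $ n * of_int (pow_coeff n (m + 1)))"
    \<comment> \<open>The term \<open>n = 0\<close> drops out because the polylogarithm has no
      constant term.\<close>
    by (intro sum.mono_neutral_right) (auto simp: Li_fps_nth)
  finally show ?thesis .
qed

text \<open>For \<open>m = l - 2\<close> the sum for \<open>C_coeff\<close> runs over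
  \<open>0 < n < l\<close>, just like the zeta sum. Adding the two gives the coefficients weighted
  by \<open>1 + pow_coeff n (l - 1)\<close>, a multiple of \<open>l\<close>.\<close>

lemma rat_cong_zeta_A:
  assumes "prime l" "odd l" "length z = length s" "set (e # z) \<subseteq> {1, - 1}"
  shows "rat_cong l (zeta_A (a # s) (e # z) l) (- C_coeff ((a - 1) # s) (e # z) (l - 2))"
proof -
  let ?c = "\<lambda>n. Li_fps (a # s) (e # z) $ n"
  have l: "l \<ge> 2" using assms(1) prime_ge_2_nat by blast
  then have C: "C_coeff ((a - 1) # s) (e # z) (l - 2) =
      (\<Sum>n\<in>{0<..<l}. ?c n * of_int (pow_coeff n (l - 1)))"
    by (simp add: C_coeff_pred Suc_diff_Suc numeral_2_eq_2)
  have c: "l_integral l (?c n)" if "n < l" for n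
    using that assms by (intro l_integral_Li_fps_nth) auto
  define w where "w n = (1 + pow_coeff n (l - 1)) div int l" for n
  have w: "1 + of_int (pow_coeff n (l - 1)) = (of_nat l * of_int (w n) :: rat)"
    if "n \<in> {0<..<l}" for n
  proof -
    have "1 + pow_coeff n (l - 1) = int l * w n"
      using dvd_Suc_pow_coeff[OF assms(1,2)] that by (simp add: w_def)
    then have "(of_int (1 + pow_coeff n (l - 1)) :: rat) = of_int (int l * w n)" by (simp only:)
    then show ?thesis by simp
  qed
  have "zeta_A (a # s) (e # z) l - (- C_coeff ((a - 1) # s) (e # z) (l - 2)) =
      (\<Sum>n\<in>{0<..<l}. ?c n * (1 + of_int (pow_coeff n (l - 1))))"
    by (simp add: C sum.distrib distrib_left flip: sum_Li_fps_nth)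
  also have "\<dots> = of_nat l * (\<Sum>n\<in>{0<..<l}. ?c n * of_int (w n))"
    unfolding sum_distrib_left by (intro sum.cong refl) (simp only: w mult_ac)
  finally have "zeta_A (a # s) (e # z) l - (- C_coeff ((a - 1) # s) (e # z) (l - 2)) =
      of_nat l * (\<Sum>n\<in>{0<..<l}. ?c n * of_int (w n))" .
  moreover have "l_integral l (\<Sum>n\<in>{0<..<l}. ?c n * of_int (w n))"
      "l_integral l (- C_coeff ((a - 1) # s) (e # z) (l - 2))"
    unfolding C
    by (auto intro!: l_integral_minus l_integral_sum l_integral_mult l_integral_of_int c assms(1))
  moreover have "l_integral l (zeta_A (a # s) (e # z) l)"
    by (auto simp flip: sum_Li_fps_nth intro!: l_integral_sum c assms(1))
  ultimately show ?thesis unfolding rat_cong_def by blast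
qed

theorem theorem2p8:
  fixes r :: nat and s :: "int list" and eps :: "rat list"
  assumes "r \<ge> 1" and "length s = r" and "length eps = r" and "set eps \<subseteq> {1, -1}"
  shows "(\<forall>l::nat. prime l \<and> odd l \<longrightarrow>
            rat_cong l (zeta_A s eps l) (- C_coeff ((hd s - 1) # tl s) eps (l - 2)))
       \<and> (\<forall>(r'::nat) (l::nat). prime l \<and> odd l \<and> l \<ge> r' + 2 \<longrightarrow>
            rat_cong l (zeta_A (replicate r' 1 @ s) (replicate r' 1 @ eps) l)
                       (- C_coeff ((hd s - 1) # tl s) eps (l - r' - 2)))"
proof -
  \<comment> \<open>Stated for arbitrary tuples, since it serves both the given tuple and the one
    extended by leading ones.\<close>
  have cong: "rat_cong l (zeta_A t z l) (- C_coeff ((hd t - 1) # tl t) z (l - 2))"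
    if "prime l" "odd l" "length z = length t" "t \<noteq> []" "set z \<subseteq> {1, - 1}" for l t z
    using that rat_cong_zeta_A by (cases t; cases z) auto
  obtain a s' e z where s: "s = a # s'" and eps: "eps = e # z"
    using assms(1-3) by (cases s; cases eps) auto
  have "rat_cong l (zeta_A (replicate k 1 @ s) (replicate k 1 @ eps) l)
      (- C_coeff ((hd s - 1) # tl s) eps (l - k - 2))"
    if "prime l" "odd l" "l \<ge> k + 2" for k l
  proof -
    have "rat_cong l (zeta_A (replicate k 1 @ s) (replicate k 1 @ eps) l)
        (- C_coeff ((hd (replicate k 1 @ s) - 1) # tl (replicate k 1 @ s))
            (replicate k 1 @ eps) (l - 2))"
      using that assms by (intro cong) auto
    \<comment> \<open>The bound \<open>l \<ge> k + 2\<close> keeps the natural subtraction from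
      truncating.\<close>
    moreover have "l - 2 = (l - k - 2) + k" using that by simp
    ultimately show ?thesis
      using C_coeff_replicate[of k a s' e z "l - k - 2"] by (simp add: s eps)
  qed
  moreover have "rat_cong l (zeta_A s eps l) (- C_coeff ((hd s - 1) # tl s) eps (l - 2))"
    if "prime l" "odd l" for l
    using that assms by (intro cong) auto
  ultimately show ?thesis by blast
qed

end
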